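(* Let $K$ be a Henselian valued field of equicharacteristic zero, considered with the three-sorted Denef--Pas language $\mathcal{L}$. Every $\mathcal{L}$-definable subset $A$ of $K^{n}$ with accumulation point $a \in K^{n}$ has, after a permutation of the coordinates, an $\mathcal{L}$-definable $x_{1}$-fiber shrinking at $a$.
   Context: $K$ is an arbitrary Henselian valued field of equicharacteristic zero (both $K$ and its residue field have characteristic zero), with valuation $v$, value group $\Gamma$ (an arbitrary ordered abelian group, of any rank), valuation ring $R$ and residue field $\Bbbk$. The Denef--Pas language $\mathcal{L}$ has three sorts: the valued field $K$ (language of rings), the value group $\Gamma \cup \{\infty\}$ (language of ordered groups with $\infty$) and the residue field $\Bbbk$ (language of rings), connected by the valuation map $v: K \to \Gamma \cup \{\infty\}$ and an angular component map $\overline{ac}: K \to \Bbbk$, i.e. a map with $\overline{ac}(0)=0$, whose restriction to $K^{\times}$ is a group homomorphism $K^{\times} \to \Bbbk^{\times}$, and which agrees with the residue map on units of $R$. Thus $K$ is equipped with such a map. "$\mathcal{L}$-definable" means definable in $\mathcal{L}$ with parameters. The $K$-topology is the topology on $K$ induced by $v$; $K^{n}$ carries the product topology. Accumulation points, neighbourhoods and limits refer to the $K$-topology. Fiber shrinking: let $A$ be an $\mathcal{L}$-definable subset of $K^{n}$ with accumulation point $a = (a_{1},\ldots,a_{n}) \in K^{n}$ and let $E$ be an $\mathcal{L}$-definable subset of $K$ with accumulation point $a_{1}$. An $\mathcal{L}$-definable family of sets $$ \Phi = \bigcup_{t \in E} \ \{ t \} \times \Phi_{t} \subset A $$ is called an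 $\mathcal{L}$-definable $x_{1}$-fiber shrinking for the set $A$ at $a$ if $$ \lim_{t \rightarrow a_{1}} \, \Phi_{t} = (a_{2},\ldots,a_{n}), $$ i.e. for any neighbourhood $U$ of $(a_{2},\ldots,a_{n}) \in K^{n-1}$, there is a neighbourhood $V$ of $a_{1} \in K$ such that $\emptyset \neq \Phi_{t} \subset U$ for every $t \in V \cap E$, $t \neq a_{1}$. When $n=1$, $A$ is itself a fiber shrinking for the subset $A$ of $K$ at an accumulation point $a \in K$. *)

theory Defs
  imports
    "HOL-Analysis.Analysis"
    "HOL-Computational_Algebra.Polynomial"
    "HOL-Combinatorics.Permutations"
begin

section \<open>The value group with infinity\<close>

datatype 'g with_inf = Fin 'g | Infinity

instantiation with_inf :: (ab_group_add) comm_monoid_add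
begin

definition zero_with_inf :: "'a with_inf" where
  "0 = Fin 0"

fun plus_with_inf :: "'a with_inf \<Rightarrow> 'a with_inf \<Rightarrow> 'a with_inf" where
  "Fin a + Fin b = Fin (a + b)"
| "Infinity + _ = Infinity"
| "_ + Infinity = Infinity"

instance
proof
  fix a b c :: "'a with_inf"
  show "a + b + c = a + (b + c)"
    by (cases a; cases b; cases c) (auto simp: add.assoc)
  show "a + b = b + a"
    by (cases a; cases b) (auto simp: add.commute)
  show "0 + a = a"
    by (cases a) (auto simp: zero_with_inf_def)
qed

end

instantiation with_inf :: (linorder) linorder
begin

fun less_eq_with_inf :: "'a with_inf \<Rightarrow> 'a with_inf \<Rightarrow> bool" where
  "Fin a \<le> Fin b \<longleftrightarrow> a \<le> b"
| "_ \<le> Infinity \<longleftrightarrow> True"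
| "Infinity \<le> Fin _ \<longleftrightarrow> False"

definition less_with_inf :: "'a with_inf \<Rightarrow> 'a with_inf \<Rightarrow> bool" where
  "(x :: 'a with_inf) < y \<longleftrightarrow> x \<le> y \<and> \<not> y \<le> x"

instance
proof
  fix x y z :: "'a with_inf"
  show "x < y \<longleftrightarrow> x \<le> y \<and> \<not> y \<le> x"
    by (rule less_with_inf_def)
  show "x \<le> x"
    by (cases x) auto
  show "x \<le> y \<Longrightarrow> y \<le> z \<Longrightarrow> x \<le> z"
    by (cases x; cases y; cases z) auto
  show "x \<le> y \<Longrightarrow> y \<le> x \<Longrightarrow> x = y"
    by (cases x; cases y) auto
  show "x \<le> y \<or> y \<le> x"
    by (cases x; cases y) auto
qed

end


section \<open>Henselian valued fields with an angular component map\<close>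

text \<open>
  The value group is the type \<open>'g\<close> and the residue field is the type \<open>'r\<close>; the latter is
  identified with the quotient of the valuation ring by its maximal ideal through the
  surjective residue map \<open>res\<close>. Only the values of \<open>res\<close> on the valuation ring
  \<open>{x. 0 \<le> v x}\<close> are meaningful.
\<close>

locale valued_field =
  fixes v :: "'k::field \<Rightarrow> 'g::linordered_ab_group_add with_inf"
    and res :: "'k \<Rightarrow> 'r::field"
  assumes v_eq_Infinity_iff: "v x = Infinity \<longleftrightarrow> x = 0"
    and v_mult: "v (x * y) = v x + v y"
    and v_add: "min (v x) (v y) \<le> v (x + y)"
    and v_surj: "range v = UNIV"
    and res_one: "res 1 = 1"
    and res_add: "0 \<le> v x \<Longrightarrow> 0 \<le> v y \<Longrightarrow> res (x + y) = res x + res y"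
    and res_mult: "0 \<le> v x \<Longrightarrow> 0 \<le> v y \<Longrightarrow> res (x * y) = res x * res y"
    and res_eq_0_iff: "0 \<le> v x \<Longrightarrow> res x = 0 \<longleftrightarrow> 0 < v x"
    and res_surj: "res ` {x. 0 \<le> v x} = UNIV"

text \<open>
  Henselian: every simple zero in the residue field of the reduction of a polynomial over the
  valuation ring lifts to a zero in the valuation ring.
\<close>

locale henselian_valued_field = valued_field +
  assumes hensel:
    "(\<And>i. 0 \<le> v (coeff f i)) \<Longrightarrow>
      poly (map_poly res f) \<alpha> = 0 \<Longrightarrow> poly (pderiv (map_poly res f)) \<alpha> \<noteq> 0 \<Longrightarrow>
      \<exists>b. 0 \<le> v b \<and> poly f b = 0 \<and> res b = \<alpha>"

text \<open>Equicharacteristic zero is expressed by the sort constraints.\<close>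

locale henselian_denef_pas_field = henselian_valued_field v res
  for v :: "'k::field_char_0 \<Rightarrow> 'g::linordered_ab_group_add with_inf"
    and res :: "'k \<Rightarrow> 'r::field_char_0" +
  fixes ac :: "'k \<Rightarrow> 'r"
  assumes ac_0: "ac 0 = 0"
    and ac_nonzero: "x \<noteq> 0 \<Longrightarrow> ac x \<noteq> 0"
    and ac_mult: "x \<noteq> 0 \<Longrightarrow> y \<noteq> 0 \<Longrightarrow> ac (x * y) = ac x * ac y"
    and ac_unit: "v x = 0 \<Longrightarrow> ac x = res x"


section \<open>The Denef--Pas language\<close>

datatype field_term =
    FVar nat | FZero | FOne | FAdd field_term field_term | FNeg field_term
  | FMul field_term field_term

datatype group_term =
    GVar nat | GZero | GInf | GAdd group_term group_term | GNeg group_term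
  | GVal field_term

datatype residue_term =
    RVar nat | RZero | ROne | RAdd residue_term residue_term | RNeg residue_term
  | RMul residue_term residue_term | RAc field_term

text \<open>Each of the three sorts has its own supply of variables, named by natural numbers.\<close>

datatype dp_formula =
    EqF field_term field_term
  | EqG group_term group_term
  | LessG group_term group_term
  | EqR residue_term residue_term
  | Neg dp_formula
  | Conj dp_formula dp_formula
  | ExF nat dp_formula
  | ExG nat dp_formula
  | ExR nat dp_formula

primrec eval_field :: "field_term \<Rightarrow> (nat \<Rightarrow> 'k::field) \<Rightarrow> 'k" where
  "eval_field (FVar i) e = e i"
| "eval_field FZero e = 0"
| "eval_field FOne e = 1"
| "eval_field (FAdd s t) e = eval_field s e + eval_field t e"
| "eval_field (FNeg t) e = - eval_field t e"
| "eval_field (FMul s t) e = eval_field s e * eval_field t e"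

text \<open>The group inverse is extended by \<open>- \<infinity> = \<infinity>\<close>.\<close>

primrec eval_group ::
  "('k::field \<Rightarrow> 'g::linordered_ab_group_add with_inf) \<Rightarrow> group_term \<Rightarrow>
    (nat \<Rightarrow> 'k) \<Rightarrow> (nat \<Rightarrow> 'g with_inf) \<Rightarrow> 'g with_inf" where
  "eval_group v (GVar i) e g = g i"
| "eval_group v GZero e g = 0"
| "eval_group v GInf e g = Infinity"
| "eval_group v (GAdd s t) e g = eval_group v s e g + eval_group v t e g"
| "eval_group v (GNeg t) e g = map_with_inf uminus (eval_group v t e g)"
| "eval_group v (GVal t) e g = v (eval_field t e)"

primrec eval_residue ::
  "('k::field \<Rightarrow> 'r::field) \<Rightarrow> residue_term \<Rightarrow> (nat \<Rightarrow> 'k) \<Rightarrow> (nat \<Rightarrow> 'r) \<Rightarrow> 'r" where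
  "eval_residue ac (RVar i) e r = r i"
| "eval_residue ac RZero e r = 0"
| "eval_residue ac ROne e r = 1"
| "eval_residue ac (RAdd s t) e r = eval_residue ac s e r + eval_residue ac t e r"
| "eval_residue ac (RNeg t) e r = - eval_residue ac t e r"
| "eval_residue ac (RMul s t) e r = eval_residue ac s e r * eval_residue ac t e r"
| "eval_residue ac (RAc t) e r = ac (eval_field t e)"

primrec sat ::
  "('k::field \<Rightarrow> 'g::linordered_ab_group_add with_inf) \<Rightarrow> ('k \<Rightarrow> 'r::field) \<Rightarrow> dp_formula \<Rightarrow>
    (nat \<Rightarrow> 'k) \<Rightarrow> (nat \<Rightarrow> 'g with_inf) \<Rightarrow> (nat \<Rightarrow> 'r) \<Rightarrow> bool" where
  "sat v ac (EqF s t) e g r \<longleftrightarrow> eval_field s e = eval_field t e"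
| "sat v ac (EqG s t) e g r \<longleftrightarrow> eval_group v s e g = eval_group v t e g"
| "sat v ac (LessG s t) e g r \<longleftrightarrow> eval_group v s e g < eval_group v t e g"
| "sat v ac (EqR s t) e g r \<longleftrightarrow> eval_residue ac s e r = eval_residue ac t e r"
| "sat v ac (Neg \<phi>) e g r \<longleftrightarrow> \<not> sat v ac \<phi> e g r"
| "sat v ac (Conj \<phi> \<psi>) e g r \<longleftrightarrow> sat v ac \<phi> e g r \<and> sat v ac \<psi> e g r"
| "sat v ac (ExF i \<phi>) e g r \<longleftrightarrow> (\<exists>x. sat v ac \<phi> (e(i := x)) g r)"
| "sat v ac (ExG i \<phi>) e g r \<longleftrightarrow> (\<exists>x. sat v ac \<phi> e (g(i := x)) r)"
| "sat v ac (ExR i \<phi>) e g r \<longleftrightarrow> (\<exists>x. sat v ac \<phi> e g (r(i := x)))"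


section \<open>Definable sets\<close>

text \<open>
  For a finite set \<open>I\<close> of indices, the affine space with coordinates indexed by \<open>I\<close> is
  represented by the functions that are extensional on \<open>I\<close>. Thus \<open>K\<^sup>n\<close> is \<open>K_space {1..n}\<close>,
  and the space of the last \<open>n - 1\<close> coordinates is \<open>K_space {2..n}\<close>.
\<close>

abbreviation K_space :: "nat set \<Rightarrow> (nat \<Rightarrow> 'k) set" where
  "K_space I \<equiv> \<Pi>\<^sub>E i\<in>I. UNIV"

text \<open>
  The assignments \<open>e\<close>, \<open>g\<close> and \<open>r\<close> supply the parameters: a formula has only finitely many
  free variables, and those other than the field variables \<open>1, \<dots>, n\<close> are read as parameters.
\<close>

definition definable ::
  "('k::field \<Rightarrow> 'g::linordered_ab_group_add with_inf) \<Rightarrow> ('k \<Rightarrow> 'r::field) \<Rightarrow> nat \<Rightarrow>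
    (nat \<Rightarrow> 'k) set \<Rightarrow> bool" where
  "definable v ac n A \<longleftrightarrow>
    (\<exists>\<phi> e g r. A = {x \<in> K_space {1..n}. sat v ac \<phi> (override_on e x {1..n}) g r})"

text \<open>Subsets of the field itself, rather than of \<open>K_space {1..1}\<close>.\<close>

definition definable_in_K ::
  "('k::field \<Rightarrow> 'g::linordered_ab_group_add with_inf) \<Rightarrow> ('k \<Rightarrow> 'r::field) \<Rightarrow> 'k set \<Rightarrow> bool" where
  "definable_in_K v ac E \<longleftrightarrow> definable v ac 1 {x \<in> K_space {1..1}. x 1 \<in> E}"


section \<open>The topology induced by the valuation\<close>

definition K_topology ::
  "('k::field \<Rightarrow> 'g::linordered_ab_group_add with_inf) \<Rightarrow> 'k topology" where
  "K_topology v = topology_generated_by {{y. Fin \<gamma> < v (y - x)} | x \<gamma>. True}"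

abbreviation K_space_topology ::
  "('k::field \<Rightarrow> 'g::linordered_ab_group_add with_inf) \<Rightarrow> nat set \<Rightarrow> (nat \<Rightarrow> 'k) topology" where
  "K_space_topology v I \<equiv> product_topology (\<lambda>_. K_topology v) I"

definition neighbourhood :: "'a topology \<Rightarrow> 'a \<Rightarrow> 'a set \<Rightarrow> bool" where
  "neighbourhood X x U \<longleftrightarrow> U \<subseteq> topspace X \<and> (\<exists>W. openin X W \<and> x \<in> W \<and> W \<subseteq> U)"


section \<open>Fiber shrinkings\<close>

text \<open>
  \<open>y(1 := t)\<close> is the point \<open>(t, y\<^sub>2, \<dots>, y\<^sub>n)\<close> and \<open>restrict a {2..n}\<close> is \<open>(a\<^sub>2, \<dots>, a\<^sub>n)\<close>.
  For \<open>n = 1\<close> the space \<open>K_space {2..n}\<close> is a point, and \<open>A\<close> is a fiber shrinking for itself.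
\<close>

definition family_union :: "'k set \<Rightarrow> ('k \<Rightarrow> (nat \<Rightarrow> 'k) set) \<Rightarrow> (nat \<Rightarrow> 'k) set" where
  "family_union E \<Phi> = (\<Union>t\<in>E. (\<lambda>y. y(1 := t)) ` \<Phi> t)"

definition fiber_shrinking ::
  "('k::field \<Rightarrow> 'g::linordered_ab_group_add with_inf) \<Rightarrow> ('k \<Rightarrow> 'r::field) \<Rightarrow> nat \<Rightarrow>
    (nat \<Rightarrow> 'k) set \<Rightarrow> (nat \<Rightarrow> 'k) \<Rightarrow> 'k set \<Rightarrow> ('k \<Rightarrow> (nat \<Rightarrow> 'k) set) \<Rightarrow> bool" where
  "fiber_shrinking v ac n A a E \<Phi> \<longleftrightarrow>
    definable_in_K v ac E \<and>
    a 1 \<in> K_topology v derived_set_of E \<and>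
    (\<forall>t\<in>E. \<Phi> t \<subseteq> K_space {2..n}) \<and>
    definable v ac n (family_union E \<Phi>) \<and>
    family_union E \<Phi> \<subseteq> A \<and>
    (\<forall>U. neighbourhood (K_space_topology v {2..n}) (restrict a {2..n}) U \<longrightarrow>
      (\<exists>V. neighbourhood (K_topology v) (a 1) V \<and>
        (\<forall>t\<in>V \<inter> E. t \<noteq> a 1 \<longrightarrow> \<Phi> t \<noteq> {} \<and> \<Phi> t \<subseteq> U)))"

end

theory Submission
  imports Defs
begin

text \<open>
  The fibres of a shrinking are sets rather than points, so no selection has to be made. Since
  there are only finitely many coordinates, \<open>A\<close> is the finite union of the sets
  \<open>A\<^sub>i = {x \<in> A. v (x\<^sub>i - a\<^sub>i) \<le> v (x\<^sub>j - a\<^sub>j) for all j}\<close>, so \<open>a\<close> is an accumulation point of some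
  \<open>A\<^sub>i\<close> (\<open>accumulation_with_dominated_coordinate\<close>); a transposition of coordinates makes \<open>i = 1\<close>.
  On this set the first coordinate controls all the others: the closer \<open>x\<^sub>1\<close> is to \<open>a\<^sub>1\<close>, the
  closer \<open>x\<close> is to \<open>a\<close>. Hence the fibres of \<open>A\<^sub>1\<close> over its projection \<open>E\<close> to the first
  coordinate shrink to \<open>(a\<^sub>2, \<dots>, a\<^sub>n)\<close>; and \<open>a\<^sub>1\<close> is an accumulation point of \<open>E\<close>, since a point
  of \<open>A\<^sub>1\<close> with \<open>x\<^sub>1 = a\<^sub>1\<close> can only be \<open>a\<close> itself
  (\<open>fiber_shrinking_if_first_coordinate_dominated\<close>).

  Definability of \<open>A\<^sub>1\<close> and of \<open>E\<close> is read off from formulas: the projection is a block of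
  existential quantifiers over the field sort, while permuting the coordinates and making room
  for the parameters \<open>a\<^sub>1, \<dots>, a\<^sub>n\<close> are both injective renamings of the field variables.
\<close>

section \<open>Renaming field variables\<close>

primrec rename_field :: "(nat \<Rightarrow> nat) \<Rightarrow> field_term \<Rightarrow> field_term" where
  "rename_field f (FVar i) = FVar (f i)"
| "rename_field f FZero = FZero"
| "rename_field f FOne = FOne"
| "rename_field f (FAdd s t) = FAdd (rename_field f s) (rename_field f t)"
| "rename_field f (FNeg t) = FNeg (rename_field f t)"
| "rename_field f (FMul s t) = FMul (rename_field f s) (rename_field f t)"

primrec rename_group :: "(nat \<Rightarrow> nat) \<Rightarrow> group_term \<Rightarrow> group_term" where
  "rename_group f (GVar i) = GVar i"
| "rename_group f GZero = GZero"
| "rename_group f GInf = GInf"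
| "rename_group f (GAdd s t) = GAdd (rename_group f s) (rename_group f t)"
| "rename_group f (GNeg t) = GNeg (rename_group f t)"
| "rename_group f (GVal t) = GVal (rename_field f t)"

primrec rename_residue :: "(nat \<Rightarrow> nat) \<Rightarrow> residue_term \<Rightarrow> residue_term" where
  "rename_residue f (RVar i) = RVar i"
| "rename_residue f RZero = RZero"
| "rename_residue f ROne = ROne"
| "rename_residue f (RAdd s t) = RAdd (rename_residue f s) (rename_residue f t)"
| "rename_residue f (RNeg t) = RNeg (rename_residue f t)"
| "rename_residue f (RMul s t) = RMul (rename_residue f s) (rename_residue f t)"
| "rename_residue f (RAc t) = RAc (rename_field f t)"

text \<open>
  Bound variables are renamed along with the free ones, so an injective renaming never captures
  a variable.
\<close>

primrec rename :: "(nat \<Rightarrow> nat) \<Rightarrow> dp_formula \<Rightarrow> dp_formula" where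
  "rename f (EqF s t) = EqF (rename_field f s) (rename_field f t)"
| "rename f (EqG s t) = EqG (rename_group f s) (rename_group f t)"
| "rename f (LessG s t) = LessG (rename_group f s) (rename_group f t)"
| "rename f (EqR s t) = EqR (rename_residue f s) (rename_residue f t)"
| "rename f (Neg \<phi>) = Neg (rename f \<phi>)"
| "rename f (Conj \<phi> \<psi>) = Conj (rename f \<phi>) (rename f \<psi>)"
| "rename f (ExF i \<phi>) = ExF (f i) (rename f \<phi>)"
| "rename f (ExG i \<phi>) = ExG i (rename f \<phi>)"
| "rename f (ExR i \<phi>) = ExR i (rename f \<phi>)"

lemma eval_rename_field: "eval_field (rename_field f t) e = eval_field t (e \<circ> f)"
  by (induction t) auto

lemma eval_rename_group: "eval_group v (rename_group f t) e g = eval_group v t (e \<circ> f) g"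
  by (induction t) (auto simp: eval_rename_field comp_def)

lemma eval_rename_residue: "eval_residue ac (rename_residue f t) e r = eval_residue ac t (e \<circ> f) r"
  by (induction t) (auto simp: eval_rename_field comp_def)

lemma sat_rename:
  assumes "inj f"
  shows "sat v ac (rename f \<phi>) e g r \<longleftrightarrow> sat v ac \<phi> (e \<circ> f) g r"
proof (induction \<phi> arbitrary: e g r)
  case (ExF i \<phi>)
  have "e(f i := x) \<circ> f = (e \<circ> f)(i := x)" for x
    using assms by (auto simp: fun_eq_iff inj_eq)
  then show ?case
    using ExF by (simp del: comp_apply fun_upd_apply)
qed (simp_all add: eval_rename_field eval_rename_group eval_rename_residue)


section \<open>Operations on definable sets\<close>

lemma sat_foldr_Conj:
  "sat v ac (foldr Conj \<theta>s \<phi>) e g r \<longleftrightarrow> (\<forall>\<theta>\<in>set \<theta>s. sat v ac \<theta> e g r) \<and> sat v ac \<phi> e g r"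
  by (induction \<theta>s) auto

lemma sat_foldr_ExF:
  "sat v ac (foldr ExF js \<phi>) e g r \<longleftrightarrow> (\<exists>y. sat v ac \<phi> (override_on e y (set js)) g r)"
proof (induction js arbitrary: e)
  case Nil
  then show ?case by simp
next
  case (Cons j js)
  have split: "override_on e y (set (j # js)) = override_on (e(j := y j)) y (set js)" for y
    by (auto simp: override_on_def fun_eq_iff)
  have merge: "override_on (e(j := x)) y (set js)
      = override_on e (if j \<in> set js then y else y(j := x)) (set (j # js))" for x y
    by (auto simp: override_on_def fun_eq_iff)
  show ?case
    unfolding foldr.simps comp_def sat.simps Cons.IH
    by (metis split merge)
qed

text \<open>
  A point \<open>x\<close> lies in the permuted set exactly when \<open>x \<circ> inv \<sigma>\<close> lies in \<open>A\<close>, so the variables of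
  the formula are renamed by \<open>inv \<sigma>\<close>. The parameters held by the variables \<open>1, \<dots>, n\<close> are
  overridden anyway, and \<open>\<sigma>\<close> fixes the others.
\<close>

lemma definable_permute_coordinates:
  assumes "definable v ac n A" "\<sigma> permutes {1..n}"
  shows "definable v ac n ((\<lambda>x. x \<circ> \<sigma>) ` A)"
proof -
  obtain \<phi> e g r where A: "A = {x \<in> K_space {1..n}. sat v ac \<phi> (override_on e x {1..n}) g r}"
    using assms(1) unfolding definable_def by blast
  have inv_perm: "inv \<sigma> permutes {1..n}"
    using assms(2) by (rule permutes_inv)
  have ext: "x \<circ> \<tau> \<in> K_space {1..n}"
    if "x \<in> K_space {1..n}" "\<tau> permutes {1..n}" for \<tau> and x :: "nat \<Rightarrow> 'a"
    using that by (auto simp: PiE_def extensional_def permutes_in_image permutes_not_in)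
  have params: "override_on (e \<circ> \<sigma>) x {1..n} \<circ> inv \<sigma> = override_on e (x \<circ> inv \<sigma>) {1..n}" for x
    using permutes_in_image[OF inv_perm] permutes_inverses(1)[OF assms(2)]
    by (auto simp: override_on_def fun_eq_iff)
  have image: "x \<in> (\<lambda>x. x \<circ> \<sigma>) ` A \<longleftrightarrow> x \<circ> inv \<sigma> \<in> A" for x
    using permutes_inv_o[OF assms(2)]
    by (auto simp: image_iff comp_assoc intro!: bexI[where x="x \<circ> inv \<sigma>"])
  have space: "x \<circ> inv \<sigma> \<in> K_space {1..n} \<longleftrightarrow> x \<in> K_space {1..n}" for x :: "nat \<Rightarrow> 'a"
    using ext[OF _ inv_perm, of x] ext[OF _ assms(2), of "x \<circ> inv \<sigma>"] permutes_inv_o[OF assms(2)]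
    by (auto simp: comp_assoc)
  have "(\<lambda>x. x \<circ> \<sigma>) ` A = {x \<in> K_space {1..n}.
      sat v ac (rename (inv \<sigma>) \<phi>) (override_on (e \<circ> \<sigma>) x {1..n}) g r}"
    unfolding set_eq_iff image sat_rename[OF permutes_inj[OF inv_perm]] params
    using space by (simp add: A del: One_nat_def)
  then show ?thesis
    unfolding definable_def by blast
qed

lemma definable_first_coordinate_dominated:
  assumes "definable v ac n A" "n \<ge> 1"
  shows "definable v ac n {x \<in> A. \<forall>j\<in>{1..n}. v (x 1 - a 1) \<le> v (x j - a j)}"
proof -
  obtain \<phi> e g r where A: "A = {x \<in> K_space {1..n}. sat v ac \<phi> (override_on e x {1..n}) g r}"
    using assms(1) unfolding definable_def by blast
  \<comment> \<open>The variables above \<open>n\<close> are shifted by \<open>n\<close>, so that \<open>n + j\<close> is free to hold \<open>a j\<close>.\<close>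
  define f where "f j = (if j \<le> n then j else j + n)" for j
  define e' where "e' j = (if j \<le> n then e j else if j \<le> n + n then a (j - n) else e (j - n))" for j
  define diff where "diff j = GVal (FAdd (FVar j) (FNeg (FVar (n + j))))" for j
  define \<theta> where "\<theta> j = Neg (LessG (diff j) (diff 1))" for j
  have inj: "inj f"
    by (auto simp: inj_on_def f_def split: if_splits)
  have old: "override_on e' x {1..n} \<circ> f = override_on e x {1..n}" for x
    by (auto simp: fun_eq_iff override_on_def f_def e'_def)
  have new: "sat v ac (\<theta> j) (override_on e' x {1..n}) g r \<longleftrightarrow> v (x 1 - a 1) \<le> v (x j - a j)"
    if "j \<in> {1..n}" for j x
    using that assms(2) by (simp add: \<theta>_def diff_def override_on_def e'_def not_less)
  have "{x \<in> A. \<forall>j\<in>{1..n}. v (x 1 - a 1) \<le> v (x j - a j)} = {x \<in> K_space {1..n}.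
      sat v ac (foldr Conj (map \<theta> [1..<Suc n]) (rename f \<phi>)) (override_on e' x {1..n}) g r}"
    by (auto simp: A sat_foldr_Conj sat_rename[OF inj] old new simp del: upt_Suc One_nat_def)
  then show ?thesis
    unfolding definable_def by blast
qed

text \<open>
  The variables \<open>2, \<dots>, n\<close> are quantified. A witness is arbitrary outside \<open>{1..n}\<close>, and has to be
  restricted to become a point of the affine space.
\<close>

lemma definable_in_K_first_coordinate:
  fixes A :: "(nat \<Rightarrow> 'k::field) set"
  assumes "definable v ac n A" "n \<ge> 1"
  shows "definable_in_K v ac ((\<lambda>x. x 1) ` A)"
proof -
  obtain \<phi> e g r where A: "A = {x \<in> K_space {1..n}. sat v ac \<phi> (override_on e x {1..n}) g r}"
    using assms(1) unfolding definable_def by blast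
  have insert: "{1..n} = insert 1 {2..n}"
    using assms(2) by auto
  have split: "override_on (override_on e x {1..1}) y {2..n} = override_on e (y(1 := x 1)) {1..n}"
    for x y
    unfolding insert by (auto simp: override_on_def fun_eq_iff)
  have "x 1 \<in> (\<lambda>x. x 1) ` A \<longleftrightarrow> (\<exists>y. sat v ac \<phi> (override_on e (y(1 := x 1)) {1..n}) g r)"
    for x :: "nat \<Rightarrow> 'k"
  proof
    assume "x 1 \<in> (\<lambda>x. x 1) ` A"
    then obtain y where "y \<in> A" "y 1 = x 1"
      by auto
    moreover from this have "y(1 := x 1) = y"
      by auto
    ultimately have "sat v ac \<phi> (override_on e (y(1 := x 1)) {1..n}) g r"
      by (simp add: A)
    then show "\<exists>y. sat v ac \<phi> (override_on e (y(1 := x 1)) {1..n}) g r"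
      by blast
  next
    assume "\<exists>y. sat v ac \<phi> (override_on e (y(1 := x 1)) {1..n}) g r"
    then obtain y where y: "sat v ac \<phi> (override_on e (y(1 := x 1)) {1..n}) g r" ..
    define z where "z = restrict (y(1 := x 1)) {1..n}"
    have "override_on e z {1..n} = override_on e (y(1 := x 1)) {1..n}"
      by (auto simp: override_on_def fun_eq_iff z_def)
    then have "z \<in> A"
      using y by (simp add: A) (simp add: z_def)
    moreover have "z 1 = x 1"
      using assms(2) by (simp add: z_def)
    ultimately show "x 1 \<in> (\<lambda>x. x 1) ` A"
      by (metis image_eqI)
  qed
  then have "{x \<in> K_space {1..1}. x 1 \<in> (\<lambda>x. x 1) ` A} = {x \<in> K_space {1..1}.
      sat v ac (foldr ExF [2..<Suc n] \<phi>) (override_on e x {1..1}) g r}"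
    by (simp only: sat_foldr_ExF set_upt atLeastLessThanSuc_atLeastAtMost split)
  then show ?thesis
    unfolding definable_in_K_def definable_def by blast
qed


section \<open>The valuation topology\<close>

context valued_field
begin

abbreviation K_ball :: "'k \<Rightarrow> 'g \<Rightarrow> 'k set" where
  "K_ball x \<gamma> \<equiv> {y. Fin \<gamma> < v (y - x)}"

abbreviation K_box :: "nat set \<Rightarrow> (nat \<Rightarrow> 'k) \<Rightarrow> 'g \<Rightarrow> (nat \<Rightarrow> 'k) set" where
  "K_box I x \<gamma> \<equiv> \<Pi>\<^sub>E i\<in>I. K_ball (x i) \<gamma>"

lemma v_0 [simp]: "v 0 = Infinity"
  by (simp add: v_eq_Infinity_iff)

lemma Fin_less_Infinity [simp]: "Fin \<gamma> < Infinity"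
  by (simp add: less_with_inf_def)

lemma openin_K_ball: "openin (K_topology v) (K_ball x \<gamma>)"
  unfolding K_topology_def by (rule topology_generated_by_Basis) blast

lemma topspace_K_topology [simp]: "topspace (K_topology v) = UNIV"
proof -
  have "x \<in> topspace (K_topology v)" for x
    using openin_subset[OF openin_K_ball[of 0 x]] by auto
  then show ?thesis
    by blast
qed

text \<open>
  By the ultrametric inequality, every point of a ball is a centre of it, and intersections of
  balls with a common centre are balls, the value group being linearly ordered.
\<close>

lemma openin_K_topology_contains_ball:
  assumes "openin (K_topology v) W" "a \<in> W"
  obtains \<gamma> where "K_ball a \<gamma> \<subseteq> W"
proof -
  have "generate_topology_on {K_ball x \<gamma> | x \<gamma>. True} W"
    using assms(1) unfolding K_topology_def openin_topology_generated_by_iff .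
  then have "a \<in> W \<longrightarrow> (\<exists>\<gamma>. K_ball a \<gamma> \<subseteq> W)"
  proof (induction rule: generate_topology_on.induct)
    case Empty
    then show ?case by simp
  next
    case (Int U V)
    show ?case
    proof
      assume "a \<in> U \<inter> V"
      then obtain \<gamma> \<delta> where "K_ball a \<gamma> \<subseteq> U" "K_ball a \<delta> \<subseteq> V"
        using Int by auto
      moreover have "K_ball a (max \<gamma> \<delta>) \<subseteq> K_ball a \<gamma> \<inter> K_ball a \<delta>"
        by (auto intro: le_less_trans[rotated])
      ultimately show "\<exists>\<gamma>. K_ball a \<gamma> \<subseteq> U \<inter> V"
        by blast
    qed
  next
    case (UN \<U>)
    then show ?case by blast
  next
    case (Basis U)
    then obtain x \<gamma> where U: "U = K_ball x \<gamma>"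
      by blast
    have "Fin \<gamma> < v (y - x)" if "Fin \<gamma> < v (a - x)" "Fin \<gamma> < v (y - a)" for y
    proof -
      have "Fin \<gamma> < min (v (y - a)) (v (a - x))"
        using that by simp
      also have "\<dots> \<le> v (y - x)"
        using v_add[of "y - a" "a - x"] by simp
      finally show ?thesis .
    qed
    then show ?case
      unfolding U by blast
  qed
  then show thesis
    using assms(2) that by blast
qed

lemma openin_K_box: "finite I \<Longrightarrow> openin (K_space_topology v I) (K_box I x \<gamma>)"
  by (simp add: openin_PiE_gen openin_K_ball)

lemma openin_K_space_contains_box:
  assumes "finite I" "openin (K_space_topology v I) W" "a \<in> W"
  obtains \<gamma> where "K_box I a \<gamma> \<subseteq> W"
proof -
  obtain U where U: "\<And>i. i \<in> I \<Longrightarrow> openin (K_topology v) (U i)" "a \<in> Pi\<^sub>E I U" "Pi\<^sub>E I U \<subseteq> W"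
    using assms(2,3) unfolding openin_product_topology_alt by fast
  have "\<forall>i\<in>I. \<exists>\<gamma>. K_ball (a i) \<gamma> \<subseteq> U i"
    using U(1,2) by (metis PiE_mem openin_K_topology_contains_ball)
  then obtain \<gamma> where \<gamma>: "\<And>i. i \<in> I \<Longrightarrow> K_ball (a i) (\<gamma> i) \<subseteq> U i"
    by metis
  \<comment> \<open>The element \<open>0\<close> is inserted to cover an empty \<open>I\<close>.\<close>
  have "K_ball (a i) (Max (insert 0 (\<gamma> ` I))) \<subseteq> K_ball (a i) (\<gamma> i)" if "i \<in> I" for i
    using that assms(1) by (auto intro: le_less_trans[rotated])
  then have "K_box I a (Max (insert 0 (\<gamma> ` I))) \<subseteq> Pi\<^sub>E I U"
    using \<gamma> by (intro PiE_mono) blast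
  also note U(3)
  finally show thesis
    by (rule that)
qed

lemma derived_set_of_K_space_iff:
  assumes "finite I"
  shows "a \<in> K_space_topology v I derived_set_of A \<longleftrightarrow>
    a \<in> K_space I \<and> (\<forall>\<gamma>. \<exists>x\<in>A \<inter> K_box I a \<gamma>. x \<noteq> a)"
proof
  assume a: "a \<in> K_space_topology v I derived_set_of A"
  then have "a \<in> K_space I"
    by (simp add: in_derived_set_of)
  moreover from this have "a \<in> K_box I a \<gamma>" for \<gamma>
    by (auto simp: PiE_iff)
  moreover have "\<exists>x. x \<noteq> a \<and> x \<in> A \<and> x \<in> W"
    if "openin (K_space_topology v I) W" "a \<in> W" for W
    using a that by (simp add: in_derived_set_of)
  ultimately show "a \<in> K_space I \<and> (\<forall>\<gamma>. \<exists>x\<in>A \<inter> K_box I a \<gamma>. x \<noteq> a)"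
    using openin_K_box[OF assms] by (meson IntI)
next
  assume R: "a \<in> K_space I \<and> (\<forall>\<gamma>. \<exists>x\<in>A \<inter> K_box I a \<gamma>. x \<noteq> a)"
  have "\<exists>x. x \<noteq> a \<and> x \<in> A \<and> x \<in> W"
    if W: "a \<in> W" "openin (K_space_topology v I) W" for W
  proof -
    obtain \<gamma> where \<gamma>: "K_box I a \<gamma> \<subseteq> W"
      using openin_K_space_contains_box[OF assms W(2,1)] .
    from R have "\<exists>x\<in>A \<inter> K_box I a \<gamma>. x \<noteq> a"
      by (elim conjE allE)
    then obtain x where "x \<in> A \<inter> K_box I a \<gamma>" "x \<noteq> a"
      by (rule bexE)
    then show ?thesis
      using subsetD[OF \<gamma>] by (intro exI[of _ x]) simp
  qed
  then show "a \<in> K_space_topology v I derived_set_of A"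
    using R unfolding in_derived_set_of by simp
qed

lemma derived_set_of_permute_coordinates:
  assumes "a \<in> K_space_topology v {1..n} derived_set_of A" "\<sigma> permutes {1..n}"
  shows "a \<circ> \<sigma> \<in> K_space_topology v {1..n} derived_set_of ((\<lambda>x. x \<circ> \<sigma>) ` A)"
proof -
  have box: "x \<circ> \<sigma> \<in> K_box {1..n} (a \<circ> \<sigma>) \<gamma>" if "x \<in> K_box {1..n} a \<gamma>" for x \<gamma>
    using that permutes_in_image[OF assms(2)]
    by (auto simp: PiE_iff extensional_def permutes_not_in[OF assms(2)])
  have "a \<circ> \<sigma> \<in> K_space {1..n}"
    using assms(1) permutes_not_in[OF assms(2)]
    by (auto simp: derived_set_of_K_space_iff PiE_iff extensional_def)
  moreover have "\<exists>y\<in>(\<lambda>x. x \<circ> \<sigma>) ` A \<inter> K_box {1..n} (a \<circ> \<sigma>) \<gamma>. y \<noteq> a \<circ> \<sigma>" for \<gamma>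
  proof -
    obtain x where x: "x \<in> A" "x \<in> K_box {1..n} a \<gamma>" "x \<noteq> a"
      using assms(1) unfolding derived_set_of_K_space_iff[OF finite_atLeastAtMost] by (metis IntE)
    moreover have "x \<circ> \<sigma> \<noteq> a \<circ> \<sigma>"
      using x(3) permutes_surj[OF assms(2)] by (metis comp_apply fun_eq_iff surjD)
    ultimately show ?thesis
      using box by blast
  qed
  ultimately show ?thesis
    by (simp add: derived_set_of_K_space_iff)
qed


section \<open>Fiber shrinkings\<close>

text \<open>
  The case in which the first coordinate is the one with the smallest valuation: the bound on
  the other coordinates makes every fibre over a point near \<open>a 1\<close> small, and the fibres are
  nonempty because the family is taken over the projection.
\<close>

lemma fiber_shrinking_if_first_coordinate_dominated:
  assumes "n \<ge> 1" "definable v ac n A"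
    and "a \<in> K_space_topology v {1..n} derived_set_of
      {x \<in> A. \<forall>j\<in>{1..n}. v (x 1 - a 1) \<le> v (x j - a j)}"
  shows "\<exists>E \<Phi>. fiber_shrinking v ac n A a E \<Phi>"
proof -
  define B where "B = {x \<in> A. \<forall>j\<in>{1..n}. v (x 1 - a 1) \<le> v (x j - a j)}"
  define E where "E = (\<lambda>x. x 1) ` B"
  define \<Phi> where "\<Phi> t = (\<lambda>x. restrict x {2..n}) ` {x \<in> B. x 1 = t}" for t
  have def_B: "definable v ac n B"
    unfolding B_def using assms(2,1) by (rule definable_first_coordinate_dominated)
  have B_space: "B \<subseteq> K_space {1..n}"
    using def_B unfolding definable_def by blast
  note acc_B = assms(3)[folded B_def, unfolded derived_set_of_K_space_iff[OF finite_atLeastAtMost]]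
  have a_space: "a \<in> K_space {1..n}"
    using acc_B by (rule conjunct1)
  have approx: "\<exists>x\<in>B \<inter> K_box {1..n} a \<gamma>. x \<noteq> a" for \<gamma>
    using acc_B by (elim conjE allE)

  have restore: "(restrict x {2..n})(1 := x 1) = x" if "x \<in> B" for x
  proof -
    have "x i = undefined" if "i \<notin> {1..n}" for i
      using B_space \<open>x \<in> B\<close> that by (meson PiE_arb subsetD)
    then show ?thesis
      by (auto simp: fun_eq_iff)
  qed
  have "(\<lambda>y. y(1 := t)) ` \<Phi> t = {x \<in> B. x 1 = t}" for t
  proof -
    have "(\<lambda>y. y(1 := t)) ` \<Phi> t = (\<lambda>x. x) ` {x \<in> B. x 1 = t}"
      unfolding \<Phi>_def image_image by (rule image_cong) (use restore in auto)
    then show ?thesis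
      by simp
  qed
  then have union: "family_union E \<Phi> = B"
    unfolding family_union_def E_def by auto

  have fst_neq: "x 1 \<noteq> a 1" if "x \<in> B" "x \<noteq> a" for x
  proof
    assume eq: "x 1 = a 1"
    \<comment> \<open>Then \<open>v (x 1 - a 1)\<close> is infinite, and so are all the valuations above it.\<close>
    have "x j = a j" if "j \<in> {1..n}" for j
    proof -
      have "Infinity \<le> v (x j - a j)"
        using \<open>x \<in> B\<close> that eq unfolding B_def by auto
      then show ?thesis
        using v_eq_Infinity_iff[of "x j - a j"] by (cases "v (x j - a j)") auto
    qed
    then have "x = a"
      using B_space a_space \<open>x \<in> B\<close> by (intro PiE_ext) auto
    with \<open>x \<noteq> a\<close> show False ..
  qed
  have acc: "a 1 \<in> K_topology v derived_set_of E"
    unfolding in_derived_set_of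
  proof (intro conjI allI impI)
    fix W assume "a 1 \<in> W \<and> openin (K_topology v) W"
    then obtain \<gamma> where \<gamma>: "K_ball (a 1) \<gamma> \<subseteq> W"
      using openin_K_topology_contains_ball by blast
    obtain x where x: "x \<in> B" "x \<in> K_box {1..n} a \<gamma>" "x \<noteq> a"
      using approx[of \<gamma>] by blast
    have "x 1 \<in> K_ball (a 1) \<gamma>"
      using x(2) assms(1) by (auto simp: PiE_iff)
    then show "\<exists>y. y \<noteq> a 1 \<and> y \<in> E \<and> y \<in> W"
      using \<gamma> fst_neq[OF x(1,3)] x(1) unfolding E_def by blast
  qed simp

  have shrink: "\<exists>V. neighbourhood (K_topology v) (a 1) V \<and>
      (\<forall>t\<in>V \<inter> E. t \<noteq> a 1 \<longrightarrow> \<Phi> t \<noteq> {} \<and> \<Phi> t \<subseteq> U)"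
    if U: "neighbourhood (K_space_topology v {2..n}) (restrict a {2..n}) U" for U
  proof -
    obtain W where W: "openin (K_space_topology v {2..n}) W" "restrict a {2..n} \<in> W" "W \<subseteq> U"
      using U unfolding neighbourhood_def by blast
    obtain \<gamma> where \<gamma>: "K_box {2..n} (restrict a {2..n}) \<gamma> \<subseteq> W"
      using openin_K_space_contains_box[OF finite_atLeastAtMost W(1,2)] .
    have "\<Phi> t \<subseteq> U" if t: "t \<in> K_ball (a 1) \<gamma>" for t
    proof
      fix y assume "y \<in> \<Phi> t"
      then obtain x where x: "x \<in> B" "x 1 = t" "y = restrict x {2..n}"
        unfolding \<Phi>_def by blast
      have "Fin \<gamma> < v (x j - a j)" if "j \<in> {2..n}" for j
      proof -
        have "v (x 1 - a 1) \<le> v (x j - a j)"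
          using x(1) that unfolding B_def by auto
        with t x(2) show ?thesis
          by auto
      qed
      then have "y \<in> K_box {2..n} (restrict a {2..n}) \<gamma>"
        unfolding x(3) by (simp add: PiE_iff)
      then show "y \<in> U"
        using \<gamma> W(3) by (meson subsetD)
    qed
    moreover have "\<Phi> t \<noteq> {}" if "t \<in> E" for t
      using that unfolding E_def \<Phi>_def by blast
    moreover have "neighbourhood (K_topology v) (a 1) (K_ball (a 1) \<gamma>)"
      unfolding neighbourhood_def
      using openin_K_ball by (auto intro!: exI[of _ "K_ball (a 1) \<gamma>"])
    ultimately show ?thesis
      by blast
  qed

  have "fiber_shrinking v ac n A a E \<Phi>"
    unfolding fiber_shrinking_def union
  proof (intro conjI allI)
    show "definable_in_K v ac E"
      unfolding E_def using def_B assms(1) by (rule definable_in_K_first_coordinate)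
    show "\<forall>t\<in>E. \<Phi> t \<subseteq> K_space {2..n}"
      unfolding \<Phi>_def by auto
    show "B \<subseteq> A"
      unfolding B_def by blast
  qed (rule def_B acc impI[OF shrink], assumption?)+
  then show ?thesis
    by blast
qed

text \<open>
  The derived set of a finite union is the union of the derived sets, and at every point some
  coordinate of \<open>x - a\<close> has the smallest valuation.
\<close>

lemma accumulation_with_dominated_coordinate:
  assumes "n \<ge> 1" "a \<in> K_space_topology v {1..n} derived_set_of A"
  obtains i where "i \<in> {1..n}"
    and "a \<in> K_space_topology v {1..n} derived_set_of
      {x \<in> A. \<forall>j\<in>{1..n}. v (x i - a i) \<le> v (x j - a j)}"
proof -
  define C where "C i = {x \<in> A. \<forall>j\<in>{1..n}. v (x i - a i) \<le> v (x j - a j)}" for i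
  have "A \<subseteq> (\<Union>i\<in>{1..n}. C i)"
  proof
    fix x assume "x \<in> A"
    obtain i where "is_arg_min (\<lambda>j. v (x j - a j)) (\<lambda>j. j \<in> {1..n}) i"
      using ex_is_arg_min_if_finite[of "{1..n}" "\<lambda>j. v (x j - a j)"] assms(1) by auto
    then have "i \<in> {1..n}" "x \<in> C i"
      using \<open>x \<in> A\<close> by (auto simp: C_def is_arg_min_linorder)
    then show "x \<in> (\<Union>i\<in>{1..n}. C i)"
      by blast
  qed
  then have "a \<in> K_space_topology v {1..n} derived_set_of (\<Union>(C ` {1..n}))"
    using assms(2) derived_set_of_mono by blast
  then have "\<exists>i\<in>{1..n}. a \<in> K_space_topology v {1..n} derived_set_of C i"
    by (simp add: derived_set_of_Union)
  then show thesis
    using that unfolding C_def by blast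
qed

end

theorem proposition2p1:
  fixes v :: "'k::field_char_0 \<Rightarrow> 'g::linordered_ab_group_add with_inf"
    and res ac :: "'k \<Rightarrow> 'r::field_char_0"
    and n :: nat and A :: "(nat \<Rightarrow> 'k) set" and a :: "nat \<Rightarrow> 'k"
  assumes "henselian_denef_pas_field v res ac"
    and "n \<ge> 1"
    and "definable v ac n A"
    and "a \<in> K_space_topology v {1..n} derived_set_of A"
  shows "\<exists>\<sigma> E \<Phi>. \<sigma> permutes {1..n} \<and>
    fiber_shrinking v ac n ((\<lambda>x. x \<circ> \<sigma>) ` A) (a \<circ> \<sigma>) E \<Phi>"
proof -
  interpret henselian_denef_pas_field v res ac
    by fact
  obtain i where i: "i \<in> {1..n}"
    and acc: "a \<in> K_space_topology v {1..n} derived_set_of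
      {x \<in> A. \<forall>j\<in>{1..n}. v (x i - a i) \<le> v (x j - a j)}" (is "_ \<in> _ derived_set_of ?C")
    using accumulation_with_dominated_coordinate[OF assms(2,4)] by blast
  define \<sigma> where "\<sigma> = Transposition.transpose 1 i"
  have perm: "\<sigma> permutes {1..n}"
    unfolding \<sigma>_def using i by (intro permutes_swap_id) auto
  have "\<sigma> 1 = i"
    by (simp add: \<sigma>_def)
  then have "(\<lambda>x. x \<circ> \<sigma>) ` ?C \<subseteq> {x \<in> (\<lambda>x. x \<circ> \<sigma>) ` A.
      \<forall>j\<in>{1..n}. v (x 1 - (a \<circ> \<sigma>) 1) \<le> v (x j - (a \<circ> \<sigma>) j)}"
    using permutes_in_image[OF perm] by auto
  then have "a \<circ> \<sigma> \<in> K_space_topology v {1..n} derived_set_of {x \<in> (\<lambda>x. x \<circ> \<sigma>) ` A.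
      \<forall>j\<in>{1..n}. v (x 1 - (a \<circ> \<sigma>) 1) \<le> v (x j - (a \<circ> \<sigma>) j)}"
    using derived_set_of_permute_coordinates[OF acc perm] derived_set_of_mono by blast
  then have "\<exists>E \<Phi>. fiber_shrinking v ac n ((\<lambda>x. x \<circ> \<sigma>) ` A) (a \<circ> \<sigma>) E \<Phi>"
    by (intro fiber_shrinking_if_first_coordinate_dominated[OF assms(2)]
        definable_permute_coordinates[OF assms(3) perm])
  then show ?thesis
    using perm by blast
qed

end
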